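(* Let $G$ be a unit-distance graph. Then there exists a regular unit-distance graph $H$ such that $G$ is (isomorphic to) a subgraph of $H$.
   Context: For $S \subseteq \mathbb{R}$, a positive integer $n$ and $d>0$, $G(S^n,d)$ denotes the graph with vertex set $S^n$ in which two vertices are adjacent if and only if their Euclidean distance is exactly $d$. A graph is a unit-distance graph if it is isomorphic to a subgraph (not necessarily induced) of $G(\mathbb{R}^2,1)$. A graph is regular if all its vertices have the same degree. *)

theory Defs
  imports "HOL-Analysis.Analysis" "HOL-Library.Equipollence"
begin

record 'v sgraph =
  verts :: "'v set"
  edges :: "'v set set"

definition simple_graph :: "'v sgraph \<Rightarrow> bool" where
  "simple_graph G \<longleftrightarrow> (\<forall>e\<in>edges G. e \<subseteq> verts G \<and> card e = 2)"

definition subgraph :: "'v sgraph \<Rightarrow> 'v sgraph \<Rightarrow> bool" where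
  "subgraph K H \<longleftrightarrow> simple_graph K \<and> simple_graph H \<and> verts K \<subseteq> verts H \<and> edges K \<subseteq> edges H"

definition graph_isomorphic :: "'v sgraph \<Rightarrow> 'w sgraph \<Rightarrow> bool" where
  "graph_isomorphic G H \<longleftrightarrow> simple_graph G \<and> simple_graph H \<and>
     (\<exists>f. bij_betw f (verts G) (verts H) \<and>
        (\<forall>u\<in>verts G. \<forall>v\<in>verts G. {u, v} \<in> edges G \<longleftrightarrow> {f u, f v} \<in> edges H))"

definition isomorphic_to_subgraph :: "'v sgraph \<Rightarrow> 'w sgraph \<Rightarrow> bool" where
  "isomorphic_to_subgraph G H \<longleftrightarrow> (\<exists>K. subgraph K H \<and> graph_isomorphic G K)"

text \<open>The graph \<open>G(S\<^sup>n, d)\<close>, with \<open>n\<close> the cardinality of the index type; meant for \<open>d > 0\<close>.\<close>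

definition distance_graph :: "real set \<Rightarrow> real \<Rightarrow> (real ^ 'n) sgraph" where
  "distance_graph S d =
     \<lparr>verts = {x. \<forall>i. x $ i \<in> S},
      edges = {{x, y} |x y. (\<forall>i. x $ i \<in> S) \<and> (\<forall>i. y $ i \<in> S) \<and> dist x y = d}\<rparr>"

definition unit_distance_graph :: "'v sgraph \<Rightarrow> bool" where
  "unit_distance_graph G \<longleftrightarrow>
     isomorphic_to_subgraph G (distance_graph UNIV 1 :: (real ^ 2) sgraph)"

definition neighbours :: "'v sgraph \<Rightarrow> 'v \<Rightarrow> 'v set" where
  "neighbours G v = {u \<in> verts G. {v, u} \<in> edges G}"

text \<open>Degrees are compared as cardinals, since \<^const>\<open>card\<close> would identify infinite
  degree with degree \<open>0\<close>.\<close>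

definition regular_graph :: "'v sgraph \<Rightarrow> bool" where
  "regular_graph G \<longleftrightarrow> (\<forall>u\<in>verts G. \<forall>v\<in>verts G. neighbours G u \<approx> neighbours G v)"

end

theory Submission imports Defs begin

text \<open>If \<open>G\<close> is infinite, the whole graph of unit distances in the plane is a suitable \<open>H\<close>, since
  translations act transitively on it. If \<open>G\<close> is finite with all degrees at most \<open>D\<close>, take \<open>G\<close>
  together with its translate by a generic unit vector \<open>u\<close>, and join \<open>v\<close> to \<open>v + u\<close> whenever the
  degree of \<open>v\<close> is less than \<open>D\<close>. This raises every deficient degree by one and keeps the others,
  so finitely many repetitions lead to a \<open>D\<close>-regular graph.\<close>

text \<open>In dimension at least two the unit sphere is connected and contains the distinct points
  \<open>b\<close> and \<open>- b\<close>. A finite connected set has at most one point, so the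
  sphere is infinite.\<close>

lemma unit_vector_avoiding_finite:
  fixes F :: "'a::euclidean_space set"
  assumes "finite F" "2 \<le> DIM('a)"
  obtains u where "norm u = 1" "u \<notin> F"
proof -
  have "connected (sphere (0::'a) 1)"
    using assms(2) by (rule connected_sphere)
  moreover obtain b :: 'a where "b \<in> Basis"
    using nonempty_Basis by blast
  then have b: "b \<in> sphere 0 1" "- b \<in> sphere 0 1" "b \<noteq> 0"
    by auto
  have "b \<noteq> - b"
  proof
    assume "b = - b"
    then have "2 *\<^sub>R b = 0"
      by (metis add.right_inverse scaleR_2)
    with b(3) show False
      by simp
  qed
  then have "\<nexists>x. sphere (0::'a) 1 = {x}"
    using b(1,2) by (metis singletonD)
  ultimately have "infinite (sphere (0::'a) 1)"
    using connected_finite_iff_sing b(1) by (metis empty_iff)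
  then obtain u where "u \<in> sphere 0 1" "u \<notin> F"
    using assms(1) by (meson finite_subset subsetI)
  then show thesis
    using that by simp
qed

text \<open>The plane graph has every point as a vertex, and every edge of a simple graph is a pair
  of points, so only the edge lengths remain to be checked.\<close>

lemma subgraph_unit_distance_iff:
  "subgraph K (distance_graph UNIV 1 :: (real ^ 'n) sgraph) \<longleftrightarrow>
    simple_graph K \<and> (\<forall>x y. {x, y} \<in> edges K \<longrightarrow> dist x y = 1)"
  (is "_ \<longleftrightarrow> ?R")
proof
  assume K: "subgraph K (distance_graph UNIV 1 :: (real ^ 'n) sgraph)"
  show ?R
  proof (intro conjI allI impI)
    fix x y assume "{x, y} \<in> edges K"
    then obtain x' y' where "{x, y} = {x', y'}" "dist x' y' = 1"
      using K by (auto simp: subgraph_def distance_graph_def)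
    then show "dist x y = 1"
      by (auto simp: doubleton_eq_iff dist_commute)
  qed (use K in \<open>simp add: subgraph_def\<close>)
next
  assume R: ?R
  have "simple_graph (distance_graph UNIV 1 :: (real ^ 'n) sgraph)"
    by (auto simp: simple_graph_def distance_graph_def card_2_iff) (metis dist_self zero_neq_one)
  moreover have "edges K \<subseteq> edges (distance_graph UNIV 1)"
  proof
    fix e assume e: "e \<in> edges K"
    then obtain x y where "e = {x, y}"
      using R by (auto simp: simple_graph_def card_2_iff)
    with e R show "e \<in> edges (distance_graph UNIV 1)"
      by (auto simp: distance_graph_def)
  qed
  ultimately show "subgraph K (distance_graph UNIV 1 :: (real ^ 'n) sgraph)"
    using R by (simp add: subgraph_def distance_graph_def)
qed

lemma graph_isomorphic_refl: "simple_graph G \<Longrightarrow> graph_isomorphic G G"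
  unfolding graph_isomorphic_def by (auto intro!: exI[of _ id])

lemma unit_distance_graph_if_subgraph:
  "subgraph H (distance_graph UNIV 1 :: (real ^ 2) sgraph) \<Longrightarrow> unit_distance_graph H"
  unfolding unit_distance_graph_def isomorphic_to_subgraph_def
  by (auto simp: subgraph_def intro: graph_isomorphic_refl)

text \<open>Translation by \<open>v - u\<close> carries the unit sphere around \<open>u\<close> onto
  the one around \<open>v\<close>. An explicit bijection is given because these neighbourhoods may
  be infinite.\<close>

lemma regular_unit_distance_plane:
  "regular_graph (distance_graph UNIV 1 :: (real ^ 'n) sgraph)"
  unfolding regular_graph_def
proof (intro ballI)
  fix u v :: "real ^ 'n"
  have N: "neighbours (distance_graph UNIV 1) w = {x. dist w x = 1}" for w :: "real ^ 'n"
    by (auto simp: neighbours_def distance_graph_def doubleton_eq_iff dist_commute)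
  have "bij_betw (\<lambda>x. x + (v - u)) {x. dist u x = 1} {x. dist v x = 1}"
    by (rule bij_betw_byWitness[where f' = "\<lambda>x. x - (v - u)"])
       (auto simp: dist_norm algebra_simps)
  then show "neighbours (distance_graph UNIV 1) u \<approx> neighbours (distance_graph UNIV 1) v"
    unfolding N eqpoll_def by blast
qed

text \<open>For disjoint copies and \<open>S = verts K\<close> this is the prism over
  \<open>K\<close>, its Cartesian product with a single edge; in general \<open>S\<close> selects
  which rungs are kept.\<close>

definition translate_join :: "'a::ab_group_add sgraph \<Rightarrow> 'a set \<Rightarrow> 'a \<Rightarrow> 'a sgraph" where
  "translate_join K S u =
    \<lparr>verts = verts K \<union> (+) u ` verts K,
     edges = edges K \<union> (`) ((+) u) ` edges K \<union> (\<lambda>v. {v, u + v}) ` S\<rparr>"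

context
  fixes K :: "'a::ab_group_add sgraph" and S :: "'a set" and u :: 'a
  assumes simple: "simple_graph K"
    and S: "S \<subseteq> verts K"
    and disj: "verts K \<inter> (+) u ` verts K = {}"
begin

lemma edge_verts: "{x, y} \<in> edges K \<Longrightarrow> x \<in> verts K \<and> y \<in> verts K"
  using simple by (auto simp: simple_graph_def)

lemma translate_edge_iff: "{x, y} \<in> (`) ((+) u) ` edges K \<longleftrightarrow> {x - u, y - u} \<in> edges K"
proof
  assume "{x, y} \<in> (`) ((+) u) ` edges K"
  then obtain e where e: "e \<in> edges K" "{x, y} = (+) u ` e"
    by blast
  have "{x - u, y - u} = (\<lambda>z. z - u) ` {x, y}"
    by simp
  also have "\<dots> = e"
    unfolding e(2) by (simp add: image_image)
  finally show "{x - u, y - u} \<in> edges K"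
    using e(1) by simp
next
  assume "{x - u, y - u} \<in> edges K"
  then have "(+) u ` {x - u, y - u} \<in> (`) ((+) u) ` edges K"
    by (rule imageI)
  then show "{x, y} \<in> (`) ((+) u) ` edges K"
    by simp
qed

text \<open>Disjointness of the copies, read pointwise. It rules out the kinds of edges that cannot
  occur at a given vertex.\<close>

lemma not_translate: "x \<in> verts K \<Longrightarrow> x - u \<notin> verts K" "x \<in> verts K \<Longrightarrow> u + x \<notin> verts K"
proof -
  show "u + x \<notin> verts K" if "x \<in> verts K" for x
    using disj that by blast
  from this[of "x - u"] show "x \<in> verts K \<Longrightarrow> x - u \<notin> verts K"
    by auto
qed

lemma simple_graph_translate_join: "simple_graph (translate_join K S u)"
proof -
  have "card {v, u + v} = 2" if "v \<in> S" for v
  proof -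
    \<comment> \<open>The two ends of a rung lie in different copies, so the rung is not a
      loop.\<close>
    have "v \<in> verts K" "u + v \<notin> verts K"
      using that S not_translate(2)[of v] by auto
    then have "v \<noteq> u + v"
      by metis
    then show ?thesis
      by (rule card_2_iff[THEN iffD2, OF exI, OF exI, OF conjI[OF refl]])
  qed
  moreover have "card ((+) u ` e) = card e" for e
    by (simp add: card_image)
  moreover have "e \<subseteq> verts K \<and> card e = 2" if "e \<in> edges K" for e
    using simple that by (simp add: simple_graph_def)
  ultimately show ?thesis
    using S unfolding simple_graph_def translate_join_def
    by (simp add: ball_Un) blast
qed

lemma edge_translate_join_iff:
  "{x, y} \<in> edges (translate_join K S u) \<longleftrightarrow>
    {x, y} \<in> edges K \<or> {x - u, y - u} \<in> edges K \<or> x \<in> S \<and> y = u + x \<or> y \<in> S \<and> x = u + y"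
proof -
  have "{x, y} \<in> (\<lambda>v. {v, u + v}) ` S \<longleftrightarrow> x \<in> S \<and> y = u + x \<or> y \<in> S \<and> x = u + y"
    unfolding image_iff doubleton_eq_iff by blast
  then show ?thesis
    by (simp add: translate_join_def translate_edge_iff)
qed

text \<open>At a vertex of the original copy no translated edge ends, and no rung arrives from
  below; only its own rung can be new.\<close>

lemma neighbours_translate_join_left:
  assumes "v \<in> verts K"
  shows "neighbours (translate_join K S u) v = neighbours K v \<union> (if v \<in> S then {u + v} else {})"
proof -
  have "{v - u, w - u} \<notin> edges K" for w
    using not_translate(1)[OF assms] edge_verts by blast
  moreover have "v \<noteq> u + w" if "w \<in> S" for w
    using not_translate(2) assms S that by blast
  ultimately have "neighbours (translate_join K S u) v =
      {w \<in> verts K \<union> (+) u ` verts K. {v, w} \<in> edges K \<or> v \<in> S \<and> w = u + v}"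
    unfolding neighbours_def edge_translate_join_iff
    by (auto simp: translate_join_def)
  also have "\<dots> = neighbours K v \<union> (if v \<in> S then {u + v} else {})"
    using assms edge_verts by (auto simp: neighbours_def)
  finally show ?thesis .
qed

text \<open>The mirror image for the translated copy: the edges of \<open>K\<close> drop out, and
  the only possible rung comes from \<open>v\<close>.\<close>

lemma neighbours_translate_join_right:
  assumes "v \<in> verts K"
  shows "neighbours (translate_join K S u) (u + v) =
    (+) u ` neighbours K v \<union> (if v \<in> S then {v} else {})"
proof -
  have "{u + v, w} \<notin> edges K" for w
    using not_translate(2)[OF assms] edge_verts by blast
  moreover have "u + v \<notin> S"
    using not_translate(2) assms S by blast
  ultimately have "neighbours (translate_join K S u) (u + v) =
      {w \<in> verts K \<union> (+) u ` verts K. {v, w - u} \<in> edges K \<or> w \<in> S \<and> v = w}"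
    unfolding neighbours_def edge_translate_join_iff
    by (auto simp: translate_join_def)
  also have "\<dots> = (+) u ` neighbours K v \<union> (if v \<in> S then {v} else {})"
  proof -
    have "w \<in> (+) u ` neighbours K v \<longleftrightarrow> {v, w - u} \<in> edges K" for w
    proof
      assume "{v, w - u} \<in> edges K"
      then have "w - u \<in> neighbours K v"
        using edge_verts by (simp add: neighbours_def)
      then show "w \<in> (+) u ` neighbours K v"
        by (rule rev_image_eqI) simp
    qed (auto simp: neighbours_def)
    moreover have "(+) u ` neighbours K v \<subseteq> (+) u ` verts K"
      by (auto simp: neighbours_def)
    ultimately show ?thesis
      using assms by auto
  qed
  finally show ?thesis .
qed

end

text \<open>Induction on \<open>k\<close>, a bound for how far any degree falls short of
  \<open>D\<close>. The graph varies in the induction because each step replaces it by a larger one;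
  at \<open>k = 0\<close> all degrees equal \<open>D\<close>.\<close>

lemma finite_regular_supergraph:
  fixes K :: "(real ^ 2) sgraph"
  assumes "subgraph K (distance_graph UNIV 1)" "finite (verts K)"
    and "\<And>v. v \<in> verts K \<Longrightarrow> card (neighbours K v) \<le> D"
    and "\<And>v. v \<in> verts K \<Longrightarrow> D \<le> card (neighbours K v) + k"
  shows "\<exists>H. subgraph H (distance_graph UNIV 1) \<and> finite (verts H) \<and> subgraph K H \<and>
    (\<forall>v\<in>verts H. card (neighbours H v) = D)"
  using assms
proof (induction k arbitrary: K)
  case 0
  then show ?case
    by (intro exI[of _ K]) (force simp: subgraph_def)
next
  case (Suc k)
  note fin = \<open>finite (verts K)\<close>
  have simple: "simple_graph K" and unit: "\<And>x y. {x, y} \<in> edges K \<Longrightarrow> dist x y = 1"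
    using Suc.prems(1) by (auto simp: subgraph_unit_distance_iff)
  \<comment> \<open>Avoiding all differences of vertices makes the copies disjoint, and norm one
    gives the rungs unit length.\<close>
  obtain u :: "real ^ 2" where u: "norm u = 1" "u \<notin> (\<lambda>(x, y). x - y) ` (verts K \<times> verts K)"
    using unit_vector_avoiding_finite[of "(\<lambda>(x, y). x - y) ` (verts K \<times> verts K)"] fin by auto
  have disj: "verts K \<inter> (+) u ` verts K = {}"
    using u(2) by (force simp: image_iff)
  \<comment> \<open>Only deficient vertices get a rung, so the upper bound \<open>D\<close> survives
    while every positive deficit drops by one.\<close>
  define S where "S = {v \<in> verts K. card (neighbours K v) < D}"
  have S: "S \<subseteq> verts K"
    by (auto simp: S_def)
  define L where "L = translate_join K S u"
  note L = simple S disj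
  have simple_L: "simple_graph L"
    unfolding L_def using L by (rule simple_graph_translate_join)
  have "dist x y = 1" if "{x, y} \<in> edges L" for x y
  proof -
    have "{x, y} \<in> edges K \<or> {x - u, y - u} \<in> edges K \<or> (\<exists>v. {x, y} = {v, u + v})"
      using that translate_edge_iff[OF L] by (auto simp: L_def translate_join_def)
    then show ?thesis
      using unit[of x y] unit[of "x - u" "y - u"] u(1)
      by (auto simp: dist_norm doubleton_eq_iff)
  qed
  with simple_L have sub_L: "subgraph L (distance_graph UNIV 1)"
    by (simp add: subgraph_unit_distance_iff)
  have fin_L: "finite (verts L)"
    using fin by (simp add: L_def translate_join_def)
  have fin_N: "finite (neighbours K v)" for v
    using fin by (simp add: neighbours_def)
  have N: "neighbours K v \<subseteq> verts K" for v
    by (auto simp: neighbours_def)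
  \<comment> \<open>Both copies \<open>w\<close> of \<open>v\<close> have the same degree. The far
    end of the rung lies in the other copy, hence is not counted already.\<close>
  have card_L: "card (neighbours L w) = card (neighbours K v) + (if v \<in> S then 1 else 0)"
    if v: "v \<in> verts K" and w: "w = v \<or> w = u + v" for v w
    using w
  proof
    assume "w = v"
    moreover have "u + v \<notin> neighbours K v"
      using not_translate(2)[OF L v] N by blast
    ultimately show ?thesis
      using neighbours_translate_join_left[OF L v] fin_N by (simp add: L_def)
  next
    assume "w = u + v"
    moreover have "v \<notin> (+) u ` neighbours K v"
      using disj v N by blast
    ultimately show ?thesis
      using neighbours_translate_join_right[OF L v] fin_N
      by (simp add: L_def card_image)
  qed
  have verts_L: "\<exists>v\<in>verts K. w = v \<or> w = u + v" if "w \<in> verts L" for w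
    using that by (auto simp: L_def translate_join_def)
  have "card (neighbours L w) \<le> D \<and> D \<le> card (neighbours L w) + k" if w: "w \<in> verts L" for w
  proof -
    obtain v where v: "v \<in> verts K" "w = v \<or> w = u + v"
      using verts_L[OF w] by blast
    show ?thesis
      using card_L[OF v] Suc.prems(3,4)[OF v(1)] v(1) by (auto simp: S_def)
  qed
  then obtain H where H: "subgraph H (distance_graph UNIV 1)" "finite (verts H)" "subgraph L H"
      "\<forall>v\<in>verts H. card (neighbours H v) = D"
    using Suc.IH[OF sub_L fin_L] by blast
  have "subgraph K H"
    using H(3) simple by (auto simp: subgraph_def L_def translate_join_def)
  with H show ?case
    by blast
qed

theorem theorem2p1:
  fixes G :: "'a sgraph"
  assumes "unit_distance_graph G"
  shows "\<exists>H :: (real ^ 2) sgraph.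
           unit_distance_graph H \<and> regular_graph H \<and> isomorphic_to_subgraph G H \<and>
           (finite (verts G) \<longrightarrow> finite (verts H))"
proof (cases "finite (verts G)")
  case False
  \<comment> \<open>The plane graph itself serves as \<open>H\<close>. Its simplicity is contained
    in the assumption on \<open>G\<close>, through \<open>subgraph\<close>.\<close>
  have "simple_graph (distance_graph UNIV 1 :: (real ^ 2) sgraph)"
    using assms by (auto simp: unit_distance_graph_def isomorphic_to_subgraph_def subgraph_def)
  then have "unit_distance_graph (distance_graph UNIV 1 :: (real ^ 2) sgraph)"
    by (intro unit_distance_graph_if_subgraph) (simp add: subgraph_def)
  then show ?thesis
    using False assms regular_unit_distance_plane unfolding unit_distance_graph_def by blast
next
  case True
  obtain K where K: "subgraph K (distance_graph UNIV 1 :: (real ^ 2) sgraph)"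
      and iso: "graph_isomorphic G K"
    using assms by (auto simp: unit_distance_graph_def isomorphic_to_subgraph_def)
  have fin: "finite (verts K)"
    using iso True by (auto simp: graph_isomorphic_def dest: bij_betw_finite)
  \<comment> \<open>The number of vertices serves both as the target degree \<open>D\<close> and as
    the initial deficit bound \<open>k\<close>.\<close>
  have "card (neighbours K v) \<le> card (verts K)" for v
    using fin by (auto simp: neighbours_def intro: card_mono)
  then obtain H where H: "subgraph H (distance_graph UNIV 1)" "finite (verts H)" "subgraph K H"
      "\<forall>v\<in>verts H. card (neighbours H v) = card (verts K)"
    using finite_regular_supergraph[OF K fin, of "card (verts K)" "card (verts K)"] by auto
  \<comment> \<open>For finite neighbourhoods equal \<open>card\<close> yields the equipollence that
    regularity asks for.\<close>
  have "finite (neighbours H v)" for v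
    using H(2) by (simp add: neighbours_def)
  then have "regular_graph H"
    using H(4) by (simp add: regular_graph_def eqpoll_iff_card)
  moreover have "isomorphic_to_subgraph G H"
    using H(3) iso by (auto simp: isomorphic_to_subgraph_def)
  ultimately show ?thesis
    using H(1,2) unit_distance_graph_if_subgraph by blast
qed

end
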